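(* Let $c_1>0$ and $c_2\ge 0$ be constants. Let $\Gamma^*\subset\mathbb{R}^2$ be a smooth, convex, closed, non-self-intersecting curve with a unique maximal diameter, placed in the coordinate frame adapted to this diameter (the maximal diameter lies on the $x$-axis and its midpoint is the origin). Let $A$ be the area enclosed by $\Gamma^*$, and suppose that $\Gamma^*$ is time-invariant, i.e. $$-1+c_1A\kappa+c_2A\,y\cos\gamma=0\qquad\text{at every point }(x,y)\in\Gamma^*,$$ where $\kappa$ is the curvature and $\gamma$ the turning angle of $\Gamma^*$ at that point. Then $\Gamma^*$ possesses $D_2$ symmetry, i.e. its symmetry group is that of a non-square rectangle.
   Context: Smooth means $C^\infty$. A closed, non-self-intersecting curve $\Gamma\subset\mathbb{R}^2$ has a unique maximal diameter if there is exactly one unordered pair of points $P,P'\in\Gamma$ with $|PP'|=\max_{X,Y\in\Gamma}|X-Y|$. The adapted frame is an orthonormal frame whose origin is the midpoint of $PP'$ and whose $x$-axis is the line $PP'$. Parametrize $\Gamma$ by arc length $s$, traversed clockwise. The turning angle $\gamma$ is the angle between the $x$ direction and the tangent, so that $x_s=\cos\gamma$, $y_s=\sin\gamma$. The curvature is $\kappa=-\gamma_s$, so $\kappa\ge 0$ for convex curves. The stationary equation expresses that the normal speed vanishes in the geometric flow $\mathbf{x}_t=c_3(-1+c_1A\kappa+c_2Ay\cos\gamma)\mathbf{n}$, where $\mathbf{n}$ is the inward unit normal and $c_3>0$. $D_2$ denotes the symmetry group of a non-square rectangle, generated here by the reflections in the $x$- and $y$-axes. *)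

theory Defs
  imports "HOL-Complex_Analysis.Complex_Analysis"
begin

text \<open>The Euclidean plane is modelled by the type \<^typ>\<open>complex\<close>: \<^const>\<open>Re\<close> and \<^const>\<open>Im\<close>
  are the coordinates \<open>x\<close> and \<open>y\<close>.\<close>

definition smooth_map :: "(real \<Rightarrow> complex) \<Rightarrow> bool" where
  "smooth_map g \<longleftrightarrow>
     (\<forall>n s. ((\<lambda>h t. vector_derivative h (at t)) ^^ n) g differentiable (at s))"

text \<open>Closed curves are parametrized by periodic functions on the whole real line, so that
  smoothness includes the point where the curve closes up; \<open>t \<mapsto> g (L * t)\<close> on \<open>[0,1]\<close> is one
  turn. Clockwise means winding number \<open>-1\<close> around the enclosed points.\<close>

definition smooth_clockwise_arclength_parametrization ::
  "(real \<Rightarrow> complex) \<Rightarrow> real \<Rightarrow> complex set \<Rightarrow> bool" where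
  "smooth_clockwise_arclength_parametrization g L \<Gamma> \<longleftrightarrow>
     0 < L \<and> smooth_map g \<and> (\<forall>s. g (s + L) = g s) \<and>
     (\<forall>s. norm (vector_derivative g (at s)) = 1) \<and>
     simple_path (\<lambda>t. g (L * t)) \<and> path_image (\<lambda>t. g (L * t)) = \<Gamma> \<and>
     (\<forall>z\<in>inside \<Gamma>. winding_number (\<lambda>t. g (L * t)) z = -1)"

definition convex_curve :: "complex set \<Rightarrow> bool" where
  "convex_curve \<Gamma> \<longleftrightarrow> convex (inside \<Gamma>)"

definition enclosed_area :: "complex set \<Rightarrow> real" where
  "enclosed_area \<Gamma> = measure lebesgue (inside \<Gamma>)"

definition turning_angle :: "(real \<Rightarrow> complex) \<Rightarrow> (real \<Rightarrow> real) \<Rightarrow> bool" where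
  "turning_angle g \<gamma> \<longleftrightarrow>
     (\<forall>s. \<gamma> differentiable (at s) \<and>
          ((\<lambda>t. Re (g t)) has_real_derivative cos (\<gamma> s)) (at s) \<and>
          ((\<lambda>t. Im (g t)) has_real_derivative sin (\<gamma> s)) (at s))"

text \<open>The sign makes the curvature of a convex curve nonnegative under clockwise traversal.\<close>

definition curvature :: "(real \<Rightarrow> real) \<Rightarrow> real \<Rightarrow> real" where
  "curvature \<gamma> s = - deriv \<gamma> s"

definition maximal_diameter :: "complex set \<Rightarrow> complex \<Rightarrow> complex \<Rightarrow> bool" where
  "maximal_diameter \<Gamma> P Q \<longleftrightarrow>
     P \<in> \<Gamma> \<and> Q \<in> \<Gamma> \<and> (\<forall>X\<in>\<Gamma>. \<forall>Y\<in>\<Gamma>. dist X Y \<le> dist P Q)"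

definition unique_maximal_diameter :: "complex set \<Rightarrow> bool" where
  "unique_maximal_diameter \<Gamma> \<longleftrightarrow> (\<exists>!e. \<exists>P Q. e = {P, Q} \<and> maximal_diameter \<Gamma> P Q)"

definition adapted_frame :: "complex set \<Rightarrow> bool" where
  "adapted_frame \<Gamma> \<longleftrightarrow>
     (\<forall>P Q. maximal_diameter \<Gamma> P Q \<longrightarrow> Im P = 0 \<and> Im Q = 0 \<and> midpoint P Q = 0)"

definition symmetry_group :: "complex set \<Rightarrow> (complex \<Rightarrow> complex) set" where
  "symmetry_group \<Gamma> = {f. bij f \<and> (\<forall>z w. dist (f z) (f w) = dist z w) \<and> f ` \<Gamma> = \<Gamma>}"

text \<open>The group generated by the reflections in the coordinate axes: \<^const>\<open>cnj\<close> reflects in the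
  \<open>x\<close>-axis, \<open>z \<mapsto> - cnj z\<close> in the \<open>y\<close>-axis, and their product is the half-turn \<^const>\<open>uminus\<close>.\<close>

definition D2 :: "(complex \<Rightarrow> complex) set" where
  "D2 = {id, cnj, \<lambda>z. - cnj z, uminus}"

end

theory Submission
  imports Defs
begin

text \<open>The pair of position \<open>g\<close> and unit tangent \<open>u = g'\<close> solves an autonomous differential
  equation whose solution set is invariant under the half-turn \<open>(g, u) \<mapsto> (-g, -u)\<close>, under
  horizontal translations, and, with time reversed, under the reflection
  \<open>(g, u) \<mapsto> (cnj g, - cnj u)\<close>. At the end points \<open>P\<close>, \<open>-P\<close> of the maximal diameter the tangent is
  vertical, so there the solution and its transform agree and hence agree everywhere. If the two
  tangents were equal rather than opposite, uniqueness would instead make \<open>\<Gamma>\<close> invariant under the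
  translation by \<open>2P\<close>, against compactness. Conversely, a symmetry of \<open>\<Gamma>\<close> has to preserve the
  unique maximal diameter.\<close>

subsection \<open>Uniqueness for the tangent equation\<close>

text \<open>The integrating factor makes \<open>E s * exp (- C * s)\<close> nonincreasing. It starts
  at 0 and is nonnegative, so it stays 0.\<close>

lemma gronwall_zero_forward:
  fixes E :: "real \<Rightarrow> real"
  assumes E: "\<And>s. (E has_real_derivative E' s) (at s)"
    and le: "\<And>s. E' s \<le> C * E s" and nonneg: "\<And>s. 0 \<le> E s"
    and zero: "E 0 = 0" and t: "0 \<le> t"
  shows "E t = 0"
proof -
  have "E t * exp (- C * t) \<le> E 0 * exp (- C * 0)"
  proof (rule DERIV_nonpos_imp_nonincreasing[OF t])
    fix s
    have "((\<lambda>s. E s * exp (- C * s)) has_real_derivative (E' s - C * E s) * exp (- C * s)) (at s)"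
      by (auto intro!: derivative_eq_intros E simp: algebra_simps)
    moreover have "(E' s - C * E s) * exp (- C * s) \<le> 0"
      using le[of s] by (simp add: mult_nonpos_nonneg)
    ultimately show "\<exists>y. ((\<lambda>s. E s * exp (- C * s)) has_real_derivative y) (at s) \<and> y \<le> 0"
      by blast
  qed
  then have "E t \<le> 0"
    using zero by (simp add: mult_le_0_iff not_le[symmetric])
  then show ?thesis
    using nonneg[of t] by simp
qed

text \<open>The bound on the absolute value of \<open>E'\<close> survives time reversal, so negative
  times reduce to the forward case for \<open>E (- s)\<close>.\<close>

lemma gronwall_zero:
  fixes E :: "real \<Rightarrow> real"
  assumes E: "\<And>s. (E has_real_derivative E' s) (at s)"
    and le: "\<And>s. \<bar>E' s\<bar> \<le> C * E s" and nonneg: "\<And>s. 0 \<le> E s"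
    and zero: "E 0 = 0"
  shows "E t = 0"
proof (cases "0 \<le> t")
  case True
  show ?thesis
    by (rule gronwall_zero_forward[OF E _ nonneg zero True]) (use le abs_le_D1 in blast)
next
  case False
  have "((\<lambda>s. E (- s)) has_real_derivative - E' (- s)) (at s)" for s
    using DERIV_chain2[OF E[of "- s"] DERIV_minus[OF DERIV_ident]] by simp
  then have "(\<lambda>s. E (- s)) (- t) = 0"
    by (rule gronwall_zero_forward[where C = C])
       (use le nonneg zero False abs_le_D2 in \<open>auto intro: less_imp_le\<close>)
  then show ?thesis by simp
qed

section \<open>The autonomous equation and its invariances\<close>

text \<open>With u = exp(i \<gamma>) this is \<gamma>' = b y cos \<gamma> - a. The unit vector
  replaces the angle to remove its ambiguity modulo 2 pi: equal tangents are then equal initial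
  data.\<close>

definition tangent_flow :: "real \<Rightarrow> real \<Rightarrow> (real \<Rightarrow> complex) \<Rightarrow> (real \<Rightarrow> complex) \<Rightarrow> bool" where
  "tangent_flow a b g u \<longleftrightarrow>
     (\<forall>s. norm (u s) = 1 \<and> (g has_vector_derivative u s) (at s) \<and>
          (u has_vector_derivative \<i> * of_real (b * Im (g s) * Re (u s) - a) * u s) (at s))"

lemma tangent_flow_shift:
  assumes "tangent_flow a b g u"
  shows "tangent_flow a b (\<lambda>s. g (s + d)) (\<lambda>s. u (s + d))"
  unfolding tangent_flow_def
proof (intro allI conjI)
  fix s
  have shift: "((\<lambda>s. f (s + d)) has_vector_derivative f') (at s)"
    if "(f has_vector_derivative f') (at (s + d))" for f :: "real \<Rightarrow> complex" and f'
  proof -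
    have "((\<lambda>s. s + d) has_vector_derivative 1) (at s)"
      by (auto intro!: derivative_eq_intros)
    from vector_diff_chain_at[OF this that] show ?thesis
      by (simp add: o_def)
  qed
  show "norm (u (s + d)) = 1"
    using assms by (simp add: tangent_flow_def)
  show "((\<lambda>s. g (s + d)) has_vector_derivative u (s + d)) (at s)"
    "((\<lambda>s. u (s + d)) has_vector_derivative
      \<i> * of_real (b * Im (g (s + d)) * Re (u (s + d)) - a) * u (s + d)) (at s)"
    using assms by (auto simp: tangent_flow_def intro!: shift)
qed

text \<open>Both \<open>Im g\<close> and \<open>Re u\<close> change sign, so the turning rate is
  unchanged. The sign from reversing time cancels the one from conjugating
  \<open>\<i>\<close>.\<close>

lemma tangent_flow_reverse_cnj:
  assumes "tangent_flow a b g u"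
  shows "tangent_flow a b (\<lambda>s. cnj (g (- s))) (\<lambda>s. - cnj (u (- s)))"
  unfolding tangent_flow_def
proof (intro allI conjI)
  fix s
  have rev: "((\<lambda>s. cnj (f (- s))) has_vector_derivative - cnj f') (at s)"
    if "(f has_vector_derivative f') (at (- s))" for f :: "real \<Rightarrow> complex" and f'
  proof -
    have "(uminus has_vector_derivative - 1) (at s)" for s :: real
      by (auto intro!: derivative_eq_intros)
    from vector_diff_chain_at[OF this that] have "((\<lambda>s. f (- s)) has_vector_derivative - f') (at s)"
      by (simp add: o_def)
    from has_vector_derivative_cnj[OF this] show ?thesis by simp
  qed
  show "norm (- cnj (u (- s))) = 1"
    using assms by (simp add: tangent_flow_def)
  show "((\<lambda>s. cnj (g (- s))) has_vector_derivative - cnj (u (- s))) (at s)"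
    using assms by (auto simp: tangent_flow_def intro!: rev)
  have "((\<lambda>s. cnj (u (- s))) has_vector_derivative
      - cnj (\<i> * of_real (b * Im (g (- s)) * Re (u (- s)) - a) * u (- s))) (at s)"
    using assms by (auto simp: tangent_flow_def simp del: complex_cnj_mult intro!: rev)
  from has_vector_derivative_minus[OF this]
  show "((\<lambda>s. - cnj (u (- s))) has_vector_derivative
      \<i> * of_real (b * Im (cnj (g (- s))) * Re (- cnj (u (- s))) - a) * - cnj (u (- s))) (at s)"
    by simp
qed

text \<open>The turning rate depends on \<open>Im g\<close> and \<open>Re u\<close> only through
  their product, in which the two signs cancel.\<close>

lemma tangent_flow_uminus:
  assumes "tangent_flow a b g u"
  shows "tangent_flow a b (\<lambda>s. - g s) (\<lambda>s. - u s)"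
  unfolding tangent_flow_def
proof (intro allI conjI)
  fix s
  have u: "norm (u s) = 1" "(g has_vector_derivative u s) (at s)"
    "(u has_vector_derivative \<i> * of_real (b * Im (g s) * Re (u s) - a) * u s) (at s)"
    using assms by (auto simp: tangent_flow_def)
  show "norm (- u s) = 1"
    using u(1) by simp
  show "((\<lambda>s. - g s) has_vector_derivative - u s) (at s)"
    by (rule has_vector_derivative_minus[OF u(2)])
  show "((\<lambda>s. - u s) has_vector_derivative
      \<i> * of_real (b * Im (- g s) * Re (- u s) - a) * - u s) (at s)"
    using has_vector_derivative_minus[OF u(3)] by simp
qed

lemma tangent_flow_translate:
  assumes "tangent_flow a b g u" "Im w = 0"
  shows "tangent_flow a b (\<lambda>s. g s + w) u"
  using assms by (simp add: tangent_flow_def has_vector_derivative_add_const)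

text \<open>Gronwall for the squared distance in position and tangent. The turning rate grows with
  the height, so a Lipschitz estimate needs a height bound; a bound along one of the two solutions
  suffices.\<close>

lemma tangent_flow_unique:
  assumes 1: "tangent_flow a b g1 u1" and 2: "tangent_flow a b g2 u2"
    and bounded: "\<And>s. \<bar>Im (g2 s)\<bar> \<le> M"
    and init: "g1 0 = g2 0" "u1 0 = u2 0"
  shows "g1 s = g2 s"
proof -
  define p where "p g u s = b * Im (g s) * Re (u s) - a"
    for g u :: "real \<Rightarrow> complex" and s
  define G where "G s = g1 s - g2 s" for s
  define U where "U s = u1 s - u2 s" for s
  define V where "V s = \<i> * of_real (p g1 u1 s) * u1 s - \<i> * of_real (p g2 u2 s) * u2 s" for s
  define E where "E s = G s \<bullet> G s + U s \<bullet> U s" for s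
  \<comment> \<open>The summand \<open>1 + \<bar>b\<bar>\<close> absorbs the mixed terms in
    \<open>norm (G s) * norm (U s)\<close>, the others the terms in the square of
    \<open>norm (U s)\<close>.\<close>
  define C where "C = 1 + \<bar>b\<bar> + 2 * \<bar>a\<bar> + 4 * \<bar>b\<bar> * M"
  have dG: "(G has_derivative (\<lambda>h. h *\<^sub>R U s)) (at s)" for s
    using 1 2 unfolding G_def U_def tangent_flow_def has_vector_derivative_def
    by (auto intro!: derivative_eq_intros simp: algebra_simps)
  have dU: "(U has_derivative (\<lambda>h. h *\<^sub>R V s)) (at s)" for s
    using 1 2 unfolding U_def V_def p_def tangent_flow_def has_vector_derivative_def
    by (auto intro!: has_derivative_eq_rhs[OF has_derivative_diff] simp: scaleR_diff_right)
  have dE: "(E has_real_derivative 2 * (G s \<bullet> U s) + 2 * (U s \<bullet> V s)) (at s)" for s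
    unfolding E_def has_field_derivative_def
    by (auto intro!: has_derivative_eq_rhs[OF has_derivative_add[OF
          has_derivative_inner[OF dG dG] has_derivative_inner[OF dU dU]]]
        simp: fun_eq_iff inner_commute algebra_simps)
  have V: "norm (V s) \<le> (\<bar>a\<bar> + 2 * \<bar>b\<bar> * M) * norm (U s) + \<bar>b\<bar> * norm (G s)" for s
  proof -
    have n: "norm (u1 s) = 1" "norm (u2 s) = 1"
      using 1 2 by (auto simp: tangent_flow_def)
    \<comment> \<open>Telescoping changes one factor at a time, arranged so that the only height
      left as a coefficient is the bounded \<open>Im (g2 s)\<close>.\<close>
    have split: "V s = \<i> * (of_real (- a) * U s + of_real b * (of_real (Im (G s) * Re (u1 s)) * u1 s
        + of_real (Im (g2 s)) * (of_real (Re (U s)) * u1 s + of_real (Re (u2 s)) * U s)))"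
      by (simp add: V_def p_def G_def U_def algebra_simps)
    have "norm (of_real (Im (G s) * Re (u1 s)) * u1 s) \<le> norm (G s) * 1"
      unfolding norm_mult norm_of_real abs_mult n mult_1_right
      using mult_mono[OF abs_Im_le_cmod[of "G s"] abs_Re_le_cmod[of "u1 s"]] n by simp
    moreover have "norm (of_real (Re (U s)) * u1 s + of_real (Re (u2 s)) * U s) \<le> 2 * norm (U s)"
    proof -
      have "norm (of_real (Re (U s)) * u1 s) \<le> norm (U s)"
        by (simp add: norm_mult n abs_Re_le_cmod)
      moreover have "norm (of_real (Re (u2 s)) * U s) \<le> norm (U s)"
        using mult_right_mono[OF abs_Re_le_cmod[of "u2 s"], of "norm (U s)"] n
        by (simp add: norm_mult)
      ultimately show ?thesis
        using norm_triangle_ineq[of "of_real (Re (U s)) * u1 s" "of_real (Re (u2 s)) * U s"]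
        by linarith
    qed
    then have "norm (of_real (Im (g2 s)) * (of_real (Re (U s)) * u1 s + of_real (Re (u2 s)) * U s))
        \<le> M * (2 * norm (U s))"
      unfolding norm_mult[of "of_real _" "_ + _"] norm_of_real
      using bounded[of s] by (intro mult_mono) auto
    ultimately have "norm (of_real (Im (G s) * Re (u1 s)) * u1 s
        + of_real (Im (g2 s)) * (of_real (Re (U s)) * u1 s + of_real (Re (u2 s)) * U s))
        \<le> norm (G s) + 2 * M * norm (U s)" (is "norm ?w \<le> ?r")
      by (intro order_trans[OF norm_triangle_ineq]) linarith
    then have "norm (of_real b * ?w) \<le> \<bar>b\<bar> * ?r"
      unfolding norm_mult[of "of_real b"] norm_of_real by (intro mult_left_mono) auto
    moreover have "norm (V s) \<le> \<bar>a\<bar> * norm (U s) + norm (of_real b * ?w)"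
      unfolding split norm_mult[of \<i>] norm_ii mult_1_left
      by (rule order_trans[OF norm_triangle_ineq]) (simp add: norm_mult)
    ultimately show ?thesis
      by (simp add: algebra_simps)
  qed
  have "\<bar>2 * (G s \<bullet> U s) + 2 * (U s \<bullet> V s)\<bar> \<le> C * E s" for s
  proof -
    let ?x = "norm (G s)" and ?y = "norm (U s)"
    have "\<bar>G s \<bullet> U s\<bar> \<le> ?x * ?y" "\<bar>U s \<bullet> V s\<bar> \<le> ?y * norm (V s)"
      by (rule Cauchy_Schwarz_ineq2)+
    moreover have "?y * norm (V s) \<le> ?y * ((\<bar>a\<bar> + 2 * \<bar>b\<bar> * M) * ?y + \<bar>b\<bar> * ?x)"
      by (intro mult_left_mono V) auto
    ultimately have "\<bar>2 * (G s \<bullet> U s) + 2 * (U s \<bullet> V s)\<bar>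
        \<le> 2 * (?x * ?y) + 2 * (?y * ((\<bar>a\<bar> + 2 * \<bar>b\<bar> * M) * ?y + \<bar>b\<bar> * ?x))"
      by linarith
    also have "\<dots> = (1 + \<bar>b\<bar>) * (2 * ?x * ?y) + (2 * \<bar>a\<bar> + 4 * \<bar>b\<bar> * M) * ?y\<^sup>2"
      by (simp add: power2_eq_square algebra_simps)
    \<comment> \<open>2xy \<le> x^2 + y^2; the last coefficient is nonnegative because
      \<open>bounded\<close> forces \<open>0 \<le> M\<close>.\<close>
    also have "\<dots> \<le> (1 + \<bar>b\<bar>) * (?x\<^sup>2 + ?y\<^sup>2) + (2 * \<bar>a\<bar> + 4 * \<bar>b\<bar> * M) * (?x\<^sup>2 + ?y\<^sup>2)"
      using bounded[of s] abs_ge_zero[of "Im (g2 s)"]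
      by (intro add_mono mult_left_mono sum_squares_bound) auto
    also have "\<dots> = C * E s"
      by (simp add: C_def E_def power2_norm_eq_inner algebra_simps)
    finally show ?thesis .
  qed
  from gronwall_zero[OF dE this] have "E s = 0"
    using init by (simp add: E_def G_def U_def)
  then show ?thesis
    by (simp add: E_def G_def add_nonneg_eq_0_iff)
qed

lemma tangent_flow_nonconstant:
  assumes "tangent_flow a b g u"
  shows "\<exists>s. g s \<noteq> w"
proof (rule ccontr)
  assume "\<not> ?thesis"
  then have "g = (\<lambda>_. w)" by auto
  then have "(g has_vector_derivative 0) (at 0)" by simp
  moreover have "(g has_vector_derivative u 0) (at 0)" "norm (u 0) = 1"
    using assms by (simp_all add: tangent_flow_def)
  ultimately show False
    using vector_derivative_unique_at by fastforce
qed

lemma tangent_flow_of_turning_angle: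
  assumes "turning_angle g \<gamma>"
    and curv: "\<And>s. deriv \<gamma> s = b * Im (g s) * cos (\<gamma> s) - a"
  shows "tangent_flow a b g (\<lambda>s. cis (\<gamma> s))"
  unfolding tangent_flow_def
proof (intro allI conjI)
  fix s
  have ta: "\<gamma> differentiable (at s)" "((\<lambda>t. Re (g t)) has_real_derivative cos (\<gamma> s)) (at s)"
    "((\<lambda>t. Im (g t)) has_real_derivative sin (\<gamma> s)) (at s)"
    using assms(1) by (auto simp: turning_angle_def)
  show "norm (cis (\<gamma> s)) = 1" by simp
  show "(g has_vector_derivative cis (\<gamma> s)) (at s)"
    using ta by (auto simp: has_vector_derivative_complex_iff has_real_derivative_iff_has_vector_derivative)
  have "(\<gamma> has_real_derivative (b * Im (g s) * cos (\<gamma> s) - a)) (at s)"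
    using ta(1) curv[of s] by (metis DERIV_deriv_iff_real_differentiable)
  then show "((\<lambda>s. cis (\<gamma> s)) has_vector_derivative
      \<i> * of_real (b * Im (g s) * Re (cis (\<gamma> s)) - a) * cis (\<gamma> s)) (at s)"
    unfolding has_vector_derivative_complex_iff
    by (auto intro!: derivative_eq_intros)
qed

subsection \<open>Symmetries\<close>

lemma periodic_nat:
  fixes g :: "real \<Rightarrow> 'a"
  assumes "\<And>s. g (s + L) = g s"
  shows "g (s + of_nat n * L) = g s"
proof (induction n)
  case (Suc n)
  then show ?case
    using assms[of "s + of_nat n * L"] by (simp add: algebra_simps)
qed simp

lemma range_periodic:
  fixes g :: "real \<Rightarrow> 'a"
  assumes per: "\<And>s. g (s + L) = g s" and "0 < L"
  shows "range g = (\<lambda>t. g (L * t)) ` {0..1}"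
proof (intro equalityI image_subsetI)
  fix s :: real
  define k where "k = \<lfloor>s / L\<rfloor>"
  have eq: "g (s - of_int k * L) = g s"
  \<comment> \<open>\<open>periodic_nat\<close> only adds periods: for \<open>0 \<le> k\<close>
    start from the reduced parameter, otherwise from \<open>s\<close>.\<close>
  proof (cases "0 \<le> k")
    case True
    then show ?thesis
      using periodic_nat[of g L "s - of_int k * L" "nat k"] per by simp
  next
    case False
    then show ?thesis
      using periodic_nat[of g L s "nat (- k)"] per by simp
  qed
  have "L * frac (s / L) = s - of_int k * L"
    using \<open>0 < L\<close> by (simp add: frac_def k_def algebra_simps)
  then have "g s = g (L * frac (s / L))" using eq by simp
  moreover have "frac (s / L) \<in> {0..1}"
    using frac_ge_0 frac_lt_1[of "s / L"] by (auto intro: less_imp_le)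
  ultimately show "g s \<in> (\<lambda>t. g (L * t)) ` {0..1}" by blast
qed auto

text \<open>As the range over the whole line, the curve is visibly unaffected by shifting or
  reversing time.\<close>

lemma smooth_clockwise_arclength_parametrization_range:
  assumes "smooth_clockwise_arclength_parametrization g L \<Gamma>"
  shows "range g = \<Gamma>" "bounded \<Gamma>"
proof -
  have g: "0 < L" "\<And>s. g (s + L) = g s" "path_image (\<lambda>t. g (L * t)) = \<Gamma>"
    "simple_path (\<lambda>t. g (L * t))"
    using assms unfolding smooth_clockwise_arclength_parametrization_def by blast+
  show "range g = \<Gamma>"
    using range_periodic[of g L] g(1-3) by (simp add: path_image_def)
  show "bounded \<Gamma>"
    using bounded_simple_path_image[OF g(4)] g(3) by simp
qed

section \<open>Plane isometries and the symmetry group\<close>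

text \<open>The distances of a point to \<open>P\<close> and \<open>- P\<close> determine its real
  part and the modulus of its imaginary part. The image of \<open>\<i>\<close> then fixes one sign
  for all points.\<close>

lemma isometry_fixing_axis:
  fixes f :: "complex \<Rightarrow> complex"
  assumes iso: "\<And>z w. dist (f z) (f w) = dist z w"
    and "Im P = 0" "P \<noteq> 0" and fix1: "f P = P" and fix2: "f (- P) = - P"
  shows "f = id \<or> f = cnj"
proof -
  have sq: "(Re (f z) - Re (f w))\<^sup>2 + (Im (f z) - Im (f w))\<^sup>2 = (Re z - Re w)\<^sup>2 + (Im z - Im w)\<^sup>2"
    for z w
    using iso[of z w] by (simp add: dist_complex_def cmod_def)
  have "Re P \<noteq> 0"
    using assms(2,3) by (simp add: complex_eq_iff)
  have Re: "Re (f z) = Re z" for z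
  proof -
    have "(Re (f z) - Re P)\<^sup>2 + (Im (f z))\<^sup>2 = (Re z - Re P)\<^sup>2 + (Im z)\<^sup>2"
      "(Re (f z) + Re P)\<^sup>2 + (Im (f z))\<^sup>2 = (Re z + Re P)\<^sup>2 + (Im z)\<^sup>2"
      using sq[of z P] sq[of z "- P"] fix1 fix2 \<open>Im P = 0\<close> by simp_all
    \<comment> \<open>Subtracting the two circle equations cancels all squares.\<close>
    then have "4 * Re (f z) * Re P = 4 * Re z * Re P"
      by algebra
    then show ?thesis using \<open>Re P \<noteq> 0\<close> by simp
  qed
  have Im: "(Im (f z))\<^sup>2 = (Im z)\<^sup>2" for z
    using sq[of z P] fix1 Re[of z] \<open>Im P = 0\<close> by simp
  from Im[of \<i>] have "Im (f \<i>) = 1 \<or> Im (f \<i>) = - 1"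
    by (simp add: power2_eq_1_iff)
  then show ?thesis
  proof
    assume i: "Im (f \<i>) = 1"
    have "Im (f z) = Im z" for z
      using sq[of z \<i>] Re[of z] Re[of \<i>] Im[of z] i by (simp add: power2_eq_square algebra_simps)
    with Re show ?thesis
      by (simp add: fun_eq_iff complex_eq_iff)
  next
    assume i: "Im (f \<i>) = - 1"
    have "Im (f z) = - Im z" for z
      using sq[of z \<i>] Re[of z] Re[of \<i>] Im[of z] i by (simp add: power2_eq_square algebra_simps)
    with Re show ?thesis
      by (simp add: fun_eq_iff complex_eq_iff)
  qed
qed

lemma isometry_preserving_axis:
  fixes f :: "complex \<Rightarrow> complex"
  assumes iso: "\<And>z w. dist (f z) (f w) = dist z w"
    and P: "Im P = 0" "P \<noteq> 0" and inv: "{f P, f (- P)} = {P, - P}"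
  shows "f \<in> D2"
proof (cases "f P = P")
  case True
  then have "f (- P) = - P"
    using inv P(2) by (auto simp: doubleton_eq_iff)
  with isometry_fixing_axis[OF iso P True] show ?thesis
    by (auto simp: D2_def)
next
  case False
  then have "- f P = P" "- f (- P) = - P"
    using inv by (auto simp: doubleton_eq_iff)
  \<comment> \<open>If \<open>f\<close> swaps the end points, composing it with the half-turn fixes
    both.\<close>
  then have "(\<lambda>z. - f z) = id \<or> (\<lambda>z. - f z) = cnj"
    using iso P by (intro isometry_fixing_axis) (auto simp: dist_minus)
  then have "f = uminus \<or> f = (\<lambda>z. - cnj z)"
    by (auto simp: fun_eq_iff) (metis minus_minus)+
  then show ?thesis
    by (auto simp: D2_def)
qed

lemma D2_subset_symmetry_group:
  assumes "cnj ` \<Gamma> = \<Gamma>" "uminus ` \<Gamma> = \<Gamma>"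
  shows "D2 \<subseteq> symmetry_group \<Gamma>"
proof -
  have "(\<lambda>z. - cnj z) ` \<Gamma> = uminus ` cnj ` \<Gamma>"
    by (simp add: image_image)
  then have img: "(\<lambda>z. - cnj z) ` \<Gamma> = \<Gamma>"
    using assms by simp
  have bij: "bij cnj" "bij (\<lambda>z. - cnj z)" "bij (uminus :: complex \<Rightarrow> complex)"
    by (rule involuntory_imp_bij; simp)+
  have dist: "dist (cnj z) (cnj w) = dist z w" for z w
    by (metis complex_cnj_diff complex_mod_cnj dist_norm)
  show ?thesis
    using assms img bij by (auto simp: D2_def symmetry_group_def dist dist_minus)
qed

lemma symmetry_group_subset_D2:
  assumes "unique_maximal_diameter \<Gamma>" and PQ: "maximal_diameter \<Gamma> P (- P)"
    and P: "Im P = 0" "P \<noteq> 0"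
  shows "symmetry_group \<Gamma> \<subseteq> D2"
proof
  fix f assume "f \<in> symmetry_group \<Gamma>"
  then have iso: "\<And>z w. dist (f z) (f w) = dist z w" and img: "f ` \<Gamma> = \<Gamma>"
    by (auto simp: symmetry_group_def)
  have "maximal_diameter \<Gamma> (f P) (f (- P))"
    using PQ img by (auto simp: maximal_diameter_def iso)
  with assms(1) PQ have "{f P, f (- P)} = {P, - P}"
    unfolding unique_maximal_diameter_def by blast
  then show "f \<in> D2"
    by (rule isometry_preserving_axis[OF iso P])
qed

section \<open>Symmetry of the curve from its diameter\<close>

lemma maximal_diameter_perpendicular:
  assumes max: "maximal_diameter \<Gamma> (g s) Q" and "range g \<subseteq> \<Gamma>"
    and d: "(g has_vector_derivative v) (at s)"
  shows "(g s - Q) \<bullet> v = 0"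
proof -
  \<comment> \<open>The squared distance to \<open>Q\<close> is differentiable everywhere, even
    where \<open>g t = Q\<close>, and has a maximum at \<open>s\<close>.\<close>
  let ?h = "\<lambda>t. (g t - Q) \<bullet> (g t - Q)"
  have dh: "(?h has_real_derivative 2 * ((g s - Q) \<bullet> v)) (at s)"
  proof -
    have "((\<lambda>t. g t - Q) has_derivative (\<lambda>h. h *\<^sub>R v)) (at s)"
      using d by (auto simp: has_vector_derivative_def intro!: derivative_eq_intros)
    from has_derivative_inner[OF this this] show ?thesis
      unfolding has_field_derivative_def
      by (rule has_derivative_eq_rhs) (simp add: fun_eq_iff inner_commute)
  qed
  have "?h t \<le> ?h s" for t
  proof -
    have "g t \<in> \<Gamma>" using assms(2) by blast
    then have "dist (g t) Q \<le> dist (g s) Q"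
      using max by (simp add: maximal_diameter_def)
    then show ?thesis
      by (simp add: dist_norm flip: power2_norm_eq_inner)
  qed
  then have "2 * ((g s - Q) \<bullet> v) = 0"
    by (intro DERIV_local_max[OF dh zero_less_one]) auto
  then show ?thesis by simp
qed

lemma involution_image_eq:
  assumes "\<And>x. f (f x) = x" "f ` S \<subseteq> S"
  shows "f ` S = S"
  using assms by (metis image_subset_iff imageI subsetI subset_antisym)

lemma tangent_flow_symmetric:
  assumes flow: "tangent_flow a b g u" and bdd: "bounded (range g)"
    and max: "maximal_diameter (range g) P (- P)" and P: "Im P = 0" "P \<noteq> 0"
  shows "cnj ` range g = range g" "uminus ` range g = range g"
proof -
  obtain B where B: "\<And>s. norm (g s) \<le> B"
    using bdd by (auto simp: bounded_iff)
  then have M: "\<bar>Im (g s)\<bar> \<le> B" for s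
    using abs_Im_le_cmod order_trans by blast
  obtain p q where p: "g p = P" and q: "g q = - P"
    using max unfolding maximal_diameter_def by (metis imageE)
  have max': "maximal_diameter (range g) (- P) P"
    using max by (simp add: maximal_diameter_def dist_commute)
  have "Re P \<noteq> 0"
    using P by (simp add: complex_eq_iff)
  have vertical: "Re (u s) = 0" if "g s = P \<or> g s = - P" for s
  proof -
    \<comment> \<open>At either end point the opposite one is \<open>- g s\<close>, so one formula
      covers both; the chord is horizontal and nonzero.\<close>
    have "(g s - (- g s)) \<bullet> u s = 0"
      using that max max' flow
      by (intro maximal_diameter_perpendicular[of "range g"]) (auto simp: tangent_flow_def)
    then show ?thesis
      using that P \<open>Re P \<noteq> 0\<close> by (auto simp: inner_complex_def)
  qed
  have tangent: "u s = \<i> \<or> u s = - \<i>" if "g s = P \<or> g s = - P" for s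
  proof -
    have "(Re (u s))\<^sup>2 + (Im (u s))\<^sup>2 = 1"
      using flow by (simp add: tangent_flow_def flip: cmod_power2)
    then have "Im (u s) = 1 \<or> Im (u s) = - 1"
      using vertical[OF that] by (simp add: power2_eq_1_iff)
    then show ?thesis
      using vertical[OF that] by (auto simp: complex_eq_iff)
  qed
  have flow_p: "tangent_flow a b (\<lambda>s. g (s + p)) (\<lambda>s. u (s + p))"
    and flow_q: "tangent_flow a b (\<lambda>s. g (s + q)) (\<lambda>s. u (s + q))"
    by (rule tangent_flow_shift[OF flow])+
  \<comment> \<open>At time 0 both solutions sit at the real point \<open>P\<close>, and u \<mapsto>
    - cnj u fixes the vertical tangents \<open>\<i>\<close> and \<open>- \<i>\<close>.\<close>
  have "cnj (g (- s + p)) = g (s + p)" for s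
    by (rule tangent_flow_unique[OF tangent_flow_reverse_cnj[OF flow_p] flow_p M])
       (use tangent[of p] p P in \<open>auto simp: complex_eq_iff\<close>)
  from this[of "p - _"] have cnj: "cnj (g s) = g (2 * p - s)" for s
    by simp
  show "cnj ` range g = range g"
    by (rule involution_image_eq) (auto simp: cnj)
  have "u q = - u p"
  proof (rule ccontr)
    assume "u q \<noteq> - u p"
    then have eq: "u q = u p"
      using tangent[of p] tangent[of q] p q by auto
    \<comment> \<open>Translating by \<open>2 * P\<close> carries \<open>- P\<close> to
      \<open>P\<close>; with equal tangents the initial data agree.\<close>
    have "g (s + q) + 2 * P = g (s + p)" for s
      by (rule tangent_flow_unique[OF tangent_flow_translate[OF flow_q] flow_p M])
         (use P p q eq in auto)
    from this[of "_ - q"] have step: "g (s + (p - q)) = g s + 2 * P" for s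
      by (simp add: algebra_simps)
    have iterate: "g (of_nat n * (p - q)) = g 0 + of_nat n * (2 * P)" for n
    proof (induction n)
      case (Suc n)
      then show ?case
        using step[of "of_nat n * (p - q)"] by (simp add: algebra_simps)
    qed simp
    have "norm (2 * P) > 0" using P by simp
    \<comment> \<open>Two points of the curve are at most \<open>2 * B\<close> apart, but
      \<open>n\<close> translations move \<open>g 0\<close> farther than that.\<close>
    then obtain n where n: "2 * B < of_nat n * norm (2 * P)"
      using reals_Archimedean3 by blast
    have "of_nat n * norm (2 * P) = norm (g (of_nat n * (p - q)) - g 0)"
      unfolding iterate by (simp add: norm_mult)
    also have "\<dots> \<le> B + B"
      by (rule order_trans[OF norm_triangle_ineq4 add_mono[OF B B]])
    finally show False using n by simp
  qed
  \<comment> \<open>The half-turn carries \<open>- P\<close> to \<open>P\<close> and, the tangents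
    being opposite, \<open>u q\<close> to \<open>u p\<close>.\<close>
  have "- g (s + q) = g (s + p)" for s
    by (rule tangent_flow_unique[OF tangent_flow_uminus[OF flow_q] flow_p M])
       (use p q \<open>u q = - u p\<close> in auto)
  from this[of "_ - q"] have minus: "- g s = g (s - q + p)" for s
    by simp
  show "uminus ` range g = range g"
    by (rule involution_image_eq) (auto simp: minus)
qed

theorem theorem1:
  fixes c1 c2 A L :: real
    and \<Gamma> :: "complex set"
    and g :: "real \<Rightarrow> complex"
    and \<gamma> :: "real \<Rightarrow> real"
  assumes "0 < c1" and "0 \<le> c2"
    and "smooth_clockwise_arclength_parametrization g L \<Gamma>"
    and "turning_angle g \<gamma>"
    and "convex_curve \<Gamma>"
    and "unique_maximal_diameter \<Gamma>"
    and "adapted_frame \<Gamma>"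
    and "A = enclosed_area \<Gamma>"
    and "\<forall>s. -1 + c1 * A * curvature \<gamma> s + c2 * A * Im (g s) * cos (\<gamma> s) = 0"
  shows "symmetry_group \<Gamma> = D2"
proof -
  \<comment> \<open>For \<open>A = 0\<close> the stationary equation would read -1 = 0.\<close>
  have "A \<noteq> 0" using assms(9) by auto
  have "deriv \<gamma> s = c2 / c1 * Im (g s) * cos (\<gamma> s) - 1 / (c1 * A)" for s
    using assms(9)[rule_format, of s] \<open>0 < c1\<close> \<open>A \<noteq> 0\<close>
    by (simp add: curvature_def field_simps)
  with assms(4) have flow: "tangent_flow (1 / (c1 * A)) (c2 / c1) g (\<lambda>s. cis (\<gamma> s))"
    by (rule tangent_flow_of_turning_angle)
  have \<Gamma>: "range g = \<Gamma>" "bounded (range g)"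
    using smooth_clockwise_arclength_parametrization_range[OF assms(3)] by simp_all
  obtain P Q where PQ: "maximal_diameter \<Gamma> P Q"
    using assms(6) unfolding unique_maximal_diameter_def by blast
  with assms(7) have "Im P = 0" "midpoint P Q = 0"
    by (auto simp: adapted_frame_def)
  then have "P + Q = 0"
    by (simp add: midpoint_def)
  then have Q: "Q = - P"
    by (rule minus_unique[symmetric])
  \<comment> \<open>If \<open>P\<close> were 0, the maximal distance would be 0 and the curve a
    single point, which unit speed excludes.\<close>
  have "\<exists>z\<in>\<Gamma>. z \<noteq> 0"
    using tangent_flow_nonconstant[OF flow] \<Gamma>(1) by blast
  then have "P \<noteq> 0"
    using PQ Q by (auto simp: maximal_diameter_def)
  from tangent_flow_symmetric[OF flow \<Gamma>(2) _ \<open>Im P = 0\<close> \<open>P \<noteq> 0\<close>]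
  have "cnj ` \<Gamma> = \<Gamma>" "uminus ` \<Gamma> = \<Gamma>"
    using PQ Q \<Gamma>(1) by auto
  then show ?thesis
    using D2_subset_symmetry_group symmetry_group_subset_D2[OF assms(6)] PQ Q
      \<open>Im P = 0\<close> \<open>P \<noteq> 0\<close> by blast
qed

end
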